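(* Let $\mathsf{CS}$ be an axiomatically appropriate and schematic constant specification for $\mathsf{JE}$. There exists a realization $r$ such that for every modal formula $A$: if $\mathsf{GE}\vdash\ \supset A$, then $\mathsf{JE}_{\mathsf{CS}}\vdash r(A)$.
   Context: Justification language. Fix countably many proof constants $\alpha_i$, proof variables $\xi_i$, and a countable set $\mathsf{Prop}$ of atomic propositions. Proof terms: $\lambda ::= \alpha_i \mid \xi_i \mid (\lambda\cdot\lambda) \mid (\lambda+\lambda) \mid\ !\lambda$. Justification terms: $t ::= \mathsf{e}(\lambda)$, $\lambda$ a proof term. Formulas: $F ::= P\mid\bot\mid(F\to F)\mid\lambda:F\mid[t]F$; other connectives are classical abbreviations. Axioms of $\mathsf{JE}$: all instances of classical propositional tautologies and of (j) $\lambda:(F\to G)\to(\kappa:F\to\lambda\cdot\kappa:G)$; (j+$_1$) $(\lambda:F\vee\kappa:F)\to(\lambda+\kappa):F$; (jt) $\lambda:F\to F$; (j4) $\lambda:F\to\ !\lambda:\lambda:F$; (je) $(\lambda:(F\to G)\wedge\lambda:(G\to F))\to([\mathsf{e}(\lambda)]F\to[\mathsf{e}(\lambda)]G)$; (je+) $([\mathsf{e}(\lambda)]F\vee[\mathsf{e}(\kappa)]F)\to[\mathsf{e}(\lambda+\kappa)]F$. A constant specification $\mathsf{CS}$ is a set of pairs $(\alpha,A)$, $\alpha$ a proof constant, $A$ an axiom of $\mathsf{JE}$; it is axiomatically appropriate if every axiom has some constant $\alpha$ with $(\alpha,A)\in\mathsf{CS}$, and schematic if for each constant $c$ the set $\{A\mid(c,A)\in\mathsf{CS}\}$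 consists of all instances of one or several (possibly zero) axiom schemes of $\mathsf{JE}$. $\mathsf{JE}_{\mathsf{CS}}$ is the Hilbert system with the axioms of $\mathsf{JE}$, modus ponens, and axiom necessitation (infer $\alpha:A$ whenever $(\alpha,A)\in\mathsf{CS}$). Modal language: $A ::= P\mid\bot\mid(A\to A)\mid\Box A$. The sequent calculus $\mathsf{GE}$ works with sequents $\Gamma\supset\Delta$ ($\Gamma,\Delta$ finite multisets of modal formulas) and has: axioms $P\supset P$ and $\bot\supset$; rules $(\to\supset)$: from $\Gamma\supset\Delta,A$ and $B,\Gamma\supset\Delta$ infer $A\to B,\Gamma\supset\Delta$; $(\supset\to)$: from $A,\Gamma\supset\Delta,B$ infer $\Gamma\supset\Delta,A\to B$; weakening on both sides (from $\Gamma\supset\Delta$ infer $A,\Gamma\supset\Delta$ and $\Gamma\supset\Delta,A$); contraction on both sides (from $A,A,\Gamma\supset\Delta$ infer $A,\Gamma\supset\Delta$; from $\Gamma\supset\Delta,A,A$ infer $\Gamma\supset\Delta,A$); and (RE): from $A\supset B$ and $B\supset A$ infer $\Box A\supset\Box B$. Realization. Let $\mathsf{Fm}^{\mathsf J}$ be the set of justification formulas with no subformula of the form $\lambda:F$. The forgetful translation $^\circ:\mathsf{Fm}^{\mathsf J}\to$ modal formulas is $\bot^\circ=\bot$, $P^\circ=P$, $(A\to B)^\circ=A^\circ\to B^\circ$, $([t]A)^\circ=\Box A^\circ$. A realization is a map $r$ from modal formulas to $\mathsf{Fm}^{\mathsf J}$ with $(r(A))^\circ=A$ for all modal $A$. 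*)

theory Defs
  imports "HOL-Library.Multiset" "HOL-Library.Countable"
begin

datatype pterm =
    PConst nat
  | PVar nat
  | PApp pterm pterm
  | PSum pterm pterm
  | PBang pterm

datatype jterm = E pterm

datatype 'p jfm =
    JAtom 'p
  | JBot
  | JImp "'p jfm" "'p jfm"
  | Proof pterm "'p jfm"
  | Just jterm "'p jfm"

definition JNot :: "'p jfm \<Rightarrow> 'p jfm" where
  "JNot F = JImp F JBot"

definition JOr :: "'p jfm \<Rightarrow> 'p jfm \<Rightarrow> 'p jfm" where
  "JOr F G = JImp (JNot F) G"

definition JAnd :: "'p jfm \<Rightarrow> 'p jfm \<Rightarrow> 'p jfm" where
  "JAnd F G = JNot (JImp F (JNot G))"

text \<open>Purely propositional formulas; their letters play the role of schematic variables
  for justification formulas.\<close>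

datatype pfm = Letter nat | Bot | Imp pfm pfm

primrec truth :: "(nat \<Rightarrow> bool) \<Rightarrow> pfm \<Rightarrow> bool" where
  "truth v (Letter n) = v n"
| "truth v Bot = False"
| "truth v (Imp A B) = (truth v A \<longrightarrow> truth v B)"

definition tautology :: "pfm \<Rightarrow> bool" where
  "tautology A \<longleftrightarrow> (\<forall>v. truth v A)"

primrec inst :: "(nat \<Rightarrow> 'p jfm) \<Rightarrow> pfm \<Rightarrow> 'p jfm" where
  "inst \<sigma> (Letter n) = \<sigma> n"
| "inst \<sigma> Bot = JBot"
| "inst \<sigma> (Imp A B) = JImp (inst \<sigma> A) (inst \<sigma> B)"

text \<open>Every classical tautology counts as an axiom scheme of its own.\<close>

datatype scheme = CL pfm | J | JPlus1 | JT | J4 | JE | JEPlus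

definition JE_schemes :: "scheme set" where
  "JE_schemes = {CL A | A. tautology A} \<union> {J, JPlus1, JT, J4, JE, JEPlus}"

primrec instances :: "scheme \<Rightarrow> 'p jfm set" where
  "instances (CL A) = {inst \<sigma> A | \<sigma>. True}"
| "instances J =
    {JImp (Proof l (JImp F G)) (JImp (Proof k F) (Proof (PApp l k) G)) | l k F G. True}"
| "instances JPlus1 =
    {JImp (JOr (Proof l F) (Proof k F)) (Proof (PSum l k) F) | l k F. True}"
| "instances JT =
    {JImp (Proof l F) F | l F. True}"
| "instances J4 =
    {JImp (Proof l F) (Proof (PBang l) (Proof l F)) | l F. True}"
| "instances JE =
    {JImp (JAnd (Proof l (JImp F G)) (Proof l (JImp G F)))
          (JImp (Just (E l) F) (Just (E l) G)) | l F G. True}"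
| "instances JEPlus =
    {JImp (JOr (Just (E l) F) (Just (E k) F)) (Just (E (PSum l k)) F) | l k F. True}"

definition JE_axioms :: "'p jfm set" where
  "JE_axioms = (\<Union>s\<in>JE_schemes. instances s)"

text \<open>Proof constants are represented by their index: the pair \<open>(c, A)\<close> stands for
  \<open>(PConst c, A)\<close>.\<close>

definition constant_specification :: "(nat \<times> 'p jfm) set \<Rightarrow> bool" where
  "constant_specification CS \<longleftrightarrow> (\<forall>(c, A)\<in>CS. A \<in> JE_axioms)"

definition axiomatically_appropriate :: "(nat \<times> 'p jfm) set \<Rightarrow> bool" where
  "axiomatically_appropriate CS \<longleftrightarrow> (\<forall>A\<in>JE_axioms. \<exists>c. (c, A) \<in> CS)"

definition schematic :: "(nat \<times> 'p jfm) set \<Rightarrow> bool" where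
  "schematic CS \<longleftrightarrow>
     (\<forall>c. \<exists>S. S \<subseteq> JE_schemes \<and> {A. (c, A) \<in> CS} = (\<Union>s\<in>S. instances s))"

inductive JE_derivable :: "(nat \<times> 'p jfm) set \<Rightarrow> 'p jfm \<Rightarrow> bool"
  for CS :: "(nat \<times> 'p jfm) set" where
  ax: "A \<in> JE_axioms \<Longrightarrow> JE_derivable CS A"
| mp: "JE_derivable CS (JImp A B) \<Longrightarrow> JE_derivable CS A \<Longrightarrow> JE_derivable CS B"
| an: "(c, A) \<in> CS \<Longrightarrow> JE_derivable CS (Proof (PConst c) A)"

datatype 'p mfm =
    MAtom 'p
  | MBot
  | MImp "'p mfm" "'p mfm"
  | Box "'p mfm"

inductive GE :: "'p mfm multiset \<Rightarrow> 'p mfm multiset \<Rightarrow> bool" where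
  AxP: "GE {#MAtom P#} {#MAtom P#}"
| AxBot: "GE {#MBot#} {#}"
| ImpL: "GE \<Gamma> (add_mset A \<Delta>) \<Longrightarrow> GE (add_mset B \<Gamma>) \<Delta> \<Longrightarrow> GE (add_mset (MImp A B) \<Gamma>) \<Delta>"
| ImpR: "GE (add_mset A \<Gamma>) (add_mset B \<Delta>) \<Longrightarrow> GE \<Gamma> (add_mset (MImp A B) \<Delta>)"
| WeakL: "GE \<Gamma> \<Delta> \<Longrightarrow> GE (add_mset A \<Gamma>) \<Delta>"
| WeakR: "GE \<Gamma> \<Delta> \<Longrightarrow> GE \<Gamma> (add_mset A \<Delta>)"
| ContrL: "GE (add_mset A (add_mset A \<Gamma>)) \<Delta> \<Longrightarrow> GE (add_mset A \<Gamma>) \<Delta>"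
| ContrR: "GE \<Gamma> (add_mset A (add_mset A \<Delta>)) \<Longrightarrow> GE \<Gamma> (add_mset A \<Delta>)"
| RE: "GE {#A#} {#B#} \<Longrightarrow> GE {#B#} {#A#} \<Longrightarrow> GE {#Box A#} {#Box B#}"

primrec subfms :: "'p jfm \<Rightarrow> 'p jfm set" where
  "subfms (JAtom P) = {JAtom P}"
| "subfms JBot = {JBot}"
| "subfms (JImp F G) = insert (JImp F G) (subfms F \<union> subfms G)"
| "subfms (Proof l F) = insert (Proof l F) (subfms F)"
| "subfms (Just t F) = insert (Just t F) (subfms F)"

definition FmJ :: "'p jfm set" where
  "FmJ = {F. \<forall>l G. Proof l G \<notin> subfms F}"

text \<open>Only meaningful on \<open>FmJ\<close>; the case of \<open>Proof\<close> is deliberately left unspecified.\<close>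

primrec (nonexhaustive) forget :: "'p jfm \<Rightarrow> 'p mfm" where
  "forget (JAtom P) = MAtom P"
| "forget JBot = MBot"
| "forget (JImp F G) = MImp (forget F) (forget G)"
| "forget (Just t F) = Box (forget F)"

definition realization :: "('p mfm \<Rightarrow> 'p jfm) \<Rightarrow> bool" where
  "realization r \<longleftrightarrow> (\<forall>A. r A \<in> FmJ \<and> forget (r A) = A)"

end

(* Every Box of the given formula is labelled with one and the same term e(l), where l is a sum
   t1 + (t2 + (... + (tn + s))) collecting, for each use of (RE), proof terms of the two
   implications between the boxed formulas. These implications contain l themselves; there
   is no circularity, because in a schematic constant specification a constant proves all
   instances of a scheme, so that the t_i can be chosen independently of l: the term for the
   conclusion of the i-th (RE) depends only on the initial part of the sum. *)
theory Submission
  imports Defs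
begin

section \<open>Realizations that label all boxes alike\<close>

instance mfm :: (countable) countable
  by countable_datatype

primrec realize :: "pterm \<Rightarrow> 'p mfm \<Rightarrow> 'p jfm" where
  "realize l (MAtom P) = JAtom P"
| "realize l MBot = JBot"
| "realize l (MImp A B) = JImp (realize l A) (realize l B)"
| "realize l (Box A) = Just (E l) (realize l A)"

lemma forget_realize: "forget (realize l A) = A"
  by (induction A) auto

lemma realize_in_FmJ: "realize l A \<in> FmJ"
  unfolding FmJ_def by (induction A) auto

subsection \<open>Constants for entire axiom schemes\<close>

text \<open>Classical valuations with \<open>Proof\<close> and \<open>Just\<close> formulas as
  atoms; they serve to show that the generic instances of \<open>JPlus1\<close> and
  \<open>JE\<close> are not instances of tautologies.\<close>

primrec jval :: "('p jfm \<Rightarrow> bool) \<Rightarrow> 'p jfm \<Rightarrow> bool" where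
  "jval v (JAtom P) = v (JAtom P)"
| "jval v JBot = False"
| "jval v (JImp F G) = (jval v F \<longrightarrow> jval v G)"
| "jval v (Proof l F) = v (Proof l F)"
| "jval v (Just t F) = v (Just t F)"

lemma jval_inst: "jval v (inst \<sigma> A) = truth (\<lambda>n. jval v (\<sigma> n)) A"
  by (induction A) auto

lemma jval_tautology: "tautology A \<Longrightarrow> F \<in> instances (CL A) \<Longrightarrow> jval v F"
  by (auto simp: jval_inst tautology_def)

text \<open>A constant specified for an instance of a scheme may be there because of a different scheme
  with the same instance (\<open>JImp JBot JBot\<close> is an instance of many). We therefore need instances
  so unspecific that every scheme they fall under contains all instances of the intended one.\<close>

definition generic :: "nat \<Rightarrow> 'p jfm" where
  "generic n = Just (E (PVar n)) JBot"

text \<open>A left inverse of \<open>inst generic\<close>. Its values on other formulas do not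
  matter, as long as it commutes with \<open>JBot\<close> and \<open>JImp\<close>.\<close>

primrec jskel :: "'p jfm \<Rightarrow> pfm" where
  "jskel (JAtom P) = Bot"
| "jskel JBot = Bot"
| "jskel (JImp F G) = Imp (jskel F) (jskel G)"
| "jskel (Proof l F) = Bot"
| "jskel (Just t F) = Letter (SOME n. Just t F = generic n)"

lemma jskel_inst_generic: "jskel (inst generic A) = A"
  by (induction A) (auto simp: generic_def)

fun subst :: "(nat \<Rightarrow> pfm) \<Rightarrow> pfm \<Rightarrow> pfm" where
  "subst \<rho> (Letter n) = \<rho> n"
| "subst \<rho> Bot = Bot"
| "subst \<rho> (Imp A B) = Imp (subst \<rho> A) (subst \<rho> B)"

lemma jskel_inst: "jskel (inst \<sigma> B) = subst (\<lambda>n. jskel (\<sigma> n)) B"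
  by (induction B) auto

lemma inst_subst: "inst \<tau> (subst \<rho> B) = inst (\<lambda>n. inst \<tau> (\<rho> n)) B"
  by (induction B) auto

text \<open>Applying \<open>jskel\<close> to the common instance exhibits \<open>A\<close> as a
  substitution instance of \<open>B\<close>; substitutions compose.\<close>

lemma instances_subset_of_generic:
  assumes "inst generic A \<in> (instances (CL B) :: 'p jfm set)"
  shows "instances (CL A) \<subseteq> (instances (CL B) :: 'p jfm set)"
proof -
  obtain \<sigma> :: "nat \<Rightarrow> 'p jfm" where "inst generic A = inst \<sigma> B"
    using assms by auto
  then have "A = subst (\<lambda>n. jskel (\<sigma> n)) B"
    by (metis jskel_inst_generic jskel_inst)
  then show ?thesis
    using inst_subst by auto
qed

text \<open>Separates generic instances of tautologies from all other schemes except
  \<open>JEPlus\<close>.\<close>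

primrec proof_free :: "'p jfm \<Rightarrow> bool" where
  "proof_free (JAtom P) = True"
| "proof_free JBot = True"
| "proof_free (JImp F G) = (proof_free F \<and> proof_free G)"
| "proof_free (Proof l F) = False"
| "proof_free (Just t F) = proof_free F"

lemma proof_free_inst_generic: "proof_free (inst generic A)"
  by (induction A) (auto simp: generic_def)

text \<open>Excludes \<open>JEPlus\<close>, whose conclusion is labelled with a sum, whereas
  \<open>generic\<close> uses only variables as labels.\<close>

lemma inst_generic_not_Just_PSum: "inst generic A \<noteq> Just (E (PSum l k)) F"
  by (cases A) (auto simp: generic_def)

lemma inst_generic_not_JEPlus: "inst generic A \<notin> instances JEPlus"
proof (cases A)
  case (Imp B C)
  then show ?thesis
    using inst_generic_not_Just_PSum[of C] by auto
qed (auto simp: generic_def)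

lemma instances_not_proof_free:
  "s \<in> {J, JPlus1, JT, J4, scheme.JE} \<Longrightarrow> F \<in> instances s \<Longrightarrow> \<not> proof_free F"
  by (auto simp: JAnd_def JOr_def JNot_def)

lemma scheme_of_inst_generic:
  assumes "inst generic A \<in> (instances s :: 'p jfm set)"
  shows "instances (CL A) \<subseteq> (instances s :: 'p jfm set)"
proof (cases s)
  case (CL B)
  then show ?thesis
    using assms instances_subset_of_generic by blast
next
  case JEPlus
  then show ?thesis
    using assms inst_generic_not_JEPlus by blast
qed (use assms proof_free_inst_generic[of A] instances_not_proof_free in blast)+

definition generic_JPlus1 :: "'p jfm" where
  "generic_JPlus1 = JImp (JOr (Proof (PVar 0) JBot) (Proof (PVar 1) JBot))
     (Proof (PSum (PVar 0) (PVar 1)) JBot)"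

lemma scheme_of_generic_JPlus1:
  assumes "s \<in> JE_schemes" "generic_JPlus1 \<in> (instances s :: 'p jfm set)"
  shows "s = JPlus1"
proof (cases s)
  case (CL B)
  then have "tautology B"
    using assms(1) by (auto simp: JE_schemes_def)
  \<comment> \<open>This valuation makes both disjuncts true and the conclusion false, so the
    formula cannot come from a tautology.\<close>
  then have "jval (\<lambda>F. F \<noteq> Proof (PSum (PVar 0) (PVar 1)) JBot) (generic_JPlus1 :: 'p jfm)"
    using assms(2) CL jval_tautology by blast
  then show ?thesis
    by (simp add: generic_JPlus1_def JOr_def JNot_def)
qed (use assms(2) in \<open>auto simp: generic_JPlus1_def JAnd_def JOr_def JNot_def\<close>)

text \<open>\<open>F\<close> and \<open>G\<close> must differ: for equal ones the axiom ends in an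
  implication from a formula to itself and is an instance of a tautology.\<close>

definition generic_JE :: "'p jfm" where
  "generic_JE = (let l = PVar 0; F = JBot; G = JImp JBot JBot in
     JImp (JAnd (Proof l (JImp F G)) (Proof l (JImp G F))) (JImp (Just (E l) F) (Just (E l) G)))"

lemma scheme_of_generic_JE:
  assumes "s \<in> JE_schemes" "generic_JE \<in> (instances s :: 'p jfm set)"
  shows "s = scheme.JE"
proof (cases s)
  case (CL B)
  then have "tautology B"
    using assms(1) by (auto simp: JE_schemes_def)
  then have "jval (\<lambda>F. F \<noteq> Just (E (PVar 0)) (JImp JBot JBot)) (generic_JE :: 'p jfm)"
    using assms(2) CL jval_tautology by blast
  then show ?thesis
    by (simp add: generic_JE_def JAnd_def JNot_def Let_def)
qed (use assms(2) in \<open>auto simp: generic_JE_def Let_def JAnd_def JOr_def JNot_def\<close>)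

subsection \<open>Propositional reasoning with modal formulas\<close>

primrec mval :: "('p mfm \<Rightarrow> bool) \<Rightarrow> 'p mfm \<Rightarrow> bool" where
  "mval v (MAtom P) = v (MAtom P)"
| "mval v MBot = False"
| "mval v (MImp A B) = (mval v A \<longrightarrow> mval v B)"
| "mval v (Box A) = v (Box A)"

primrec mskel :: "'p::countable mfm \<Rightarrow> pfm" where
  "mskel (MAtom P) = Letter (to_nat (MAtom P))"
| "mskel MBot = Bot"
| "mskel (MImp A B) = Imp (mskel A) (mskel B)"
| "mskel (Box A) = Letter (to_nat (Box A))"

lemma truth_mskel: "truth w (mskel A) = mval (\<lambda>B. w (to_nat B)) A"
  by (induction A) auto

text \<open>Since \<open>mskel A\<close> does not depend on \<open>l\<close>, the realizations under
  all labels are instances of one scheme and can share a constant.\<close>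

lemma inst_mskel: "inst (\<lambda>n. realize l (from_nat n)) (mskel A) = realize l A"
  by (induction A) auto

text \<open>\<open>Gs\<close> is meant for the implications between boxes that come from (RE); the
  rest of a derivation is propositional, with boxes as atoms.\<close>

definition entails :: "'p mfm list \<Rightarrow> 'p mfm set \<Rightarrow> 'p mfm set \<Rightarrow> bool" where
  "entails Gs X Y \<longleftrightarrow>
     (\<forall>v. (\<forall>G\<in>set Gs. mval v G) \<longrightarrow> (\<forall>A\<in>X. mval v A) \<longrightarrow> (\<exists>B\<in>Y. mval v B))"

section \<open>Schematic specifications: one constant for all instances\<close>

locale schematic_appropriate =
  fixes CS :: "(nat \<times> 'p::countable jfm) set"
  assumes appropriate: "axiomatically_appropriate CS"
    and schematic: "schematic CS"
begin

abbreviation derivable :: "'p jfm \<Rightarrow> bool" where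
  "derivable \<equiv> JE_derivable CS"

lemma derivable_instance: "s \<in> JE_schemes \<Longrightarrow> F \<in> instances s \<Longrightarrow> derivable F"
  by (rule JE_derivable.ax) (auto simp: JE_axioms_def)

text \<open>Appropriateness gives a constant for \<open>F\<close>. By schematicity it also covers
  all instances of some scheme containing \<open>F\<close>, and the last assumption puts the
  instances of \<open>s\<close> among them.\<close>

lemma constant_for_instances:
  fixes F :: "'p jfm"
  assumes "s \<in> JE_schemes" "F \<in> instances s"
    and "\<And>s'. s' \<in> JE_schemes \<Longrightarrow> F \<in> instances s' \<Longrightarrow> instances s \<subseteq> (instances s' :: 'p jfm set)"
  obtains c where "\<And>G. G \<in> instances s \<Longrightarrow> derivable (Proof (PConst c) G)"
proof -
  have "F \<in> JE_axioms"
    using assms(1,2) by (auto simp: JE_axioms_def)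
  then obtain c where c: "(c, F) \<in> CS"
    using appropriate by (auto simp: axiomatically_appropriate_def)
  obtain S where S: "S \<subseteq> JE_schemes" "{A. (c, A) \<in> CS} = (\<Union>s\<in>S. instances s)"
    using schematic unfolding schematic_def by meson
  then obtain s' where s': "s' \<in> S" "F \<in> instances s'"
    using c by blast
  then have "instances s \<subseteq> {A. (c, A) \<in> CS}"
    using S assms(3) by blast
  then show thesis
    using that[of c] JE_derivable.an by blast
qed

lemma constant_for_tautology:
  assumes "tautology A"
  obtains c where "\<And>\<tau>. derivable (Proof (PConst c) (inst \<tau> A))"
proof (rule constant_for_instances[of "CL A" "inst generic A"])
  show "CL A \<in> JE_schemes"
    using assms by (auto simp: JE_schemes_def)
  show "inst generic A \<in> instances (CL A)"
    by auto
  show "\<And>s'. s' \<in> JE_schemes \<Longrightarrow> inst generic A \<in> (instances s' :: 'p jfm set) \<Longrightarrow>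
      instances (CL A) \<subseteq> (instances s' :: 'p jfm set)"
    by (rule scheme_of_inst_generic)
next
  fix c
  assume "\<And>G. G \<in> instances (CL A) \<Longrightarrow> derivable (Proof (PConst c) G)"
  then show thesis
    by (intro that[of c]) auto
qed

lemma constant_for_JPlus1:
  obtains c where "\<And>l k F. derivable (Proof (PConst c)
      (JImp (JOr (Proof l F) (Proof k F)) (Proof (PSum l k) F)))"
proof (rule constant_for_instances[of JPlus1 generic_JPlus1])
  show "JPlus1 \<in> JE_schemes"
    by (auto simp: JE_schemes_def)
  show "generic_JPlus1 \<in> instances JPlus1"
    by (auto simp: generic_JPlus1_def)
  show "\<And>s'. s' \<in> JE_schemes \<Longrightarrow> generic_JPlus1 \<in> (instances s' :: 'p jfm set) \<Longrightarrow>
      instances JPlus1 \<subseteq> (instances s' :: 'p jfm set)"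
    using scheme_of_generic_JPlus1 by blast
next
  fix c
  assume "\<And>G. G \<in> instances JPlus1 \<Longrightarrow> derivable (Proof (PConst c) G)"
  then show thesis
    by (intro that[of c]) auto
qed

lemma constant_for_JE:
  obtains c where "\<And>l F G. derivable (Proof (PConst c)
      (JImp (JAnd (Proof l (JImp F G)) (Proof l (JImp G F)))
        (JImp (Just (E l) F) (Just (E l) G))))"
proof (rule constant_for_instances[of scheme.JE generic_JE])
  show "scheme.JE \<in> JE_schemes"
    by (auto simp: JE_schemes_def)
  show "generic_JE \<in> instances scheme.JE"
    by (auto simp: generic_JE_def Let_def)
  show "\<And>s'. s' \<in> JE_schemes \<Longrightarrow> generic_JE \<in> (instances s' :: 'p jfm set) \<Longrightarrow>
      instances scheme.JE \<subseteq> (instances s' :: 'p jfm set)"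
    using scheme_of_generic_JE by blast
next
  fix c
  assume "\<And>G. G \<in> instances scheme.JE \<Longrightarrow> derivable (Proof (PConst c) G)"
  then show thesis
    by (intro that[of c]) auto
qed

subsection \<open>Internalised derivations\<close>

lemma derivable_PApp:
  assumes "derivable (Proof t (JImp F G))" "derivable (Proof s F)"
  shows "derivable (Proof (PApp t s) G)"
proof -
  have "derivable (JImp (Proof t (JImp F G)) (JImp (Proof s F) (Proof (PApp t s) G)))"
    by (rule derivable_instance[of scheme.J]) (auto simp: JE_schemes_def)
  then show ?thesis
    using assms JE_derivable.mp by blast
qed

lemma derivable_PBang:
  assumes "derivable (Proof t F)"
  shows "derivable (Proof (PBang t) (Proof t F))"
proof -
  have "derivable (JImp (Proof t F) (Proof (PBang t) (Proof t F)))"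
    by (rule derivable_instance[of J4]) (auto simp: JE_schemes_def)
  then show ?thesis
    using assms JE_derivable.mp by blast
qed

lemma derivable_reflection:
  assumes "derivable (Proof t F)"
  shows "derivable F"
proof -
  have "derivable (JImp (Proof t F) F)"
    by (rule derivable_instance[of JT]) (auto simp: JE_schemes_def)
  then show ?thesis
    using assms JE_derivable.mp by blast
qed

section \<open>Uniform terms for passing from a summand to a sum\<close>

lemma term_for_PSum_left:
  obtains u where "\<And>l k F. derivable (Proof u (JImp (Proof l F) (Proof (PSum l k) F)))"
proof -
  let ?A = "Imp (Imp (Imp (Imp (Letter 0) Bot) (Letter 1)) (Letter 2)) (Imp (Letter 0) (Letter 2))"
  have "tautology ?A"
    by (auto simp: tautology_def)
  then obtain c where c: "\<And>\<tau>. derivable (Proof (PConst c) (inst \<tau> ?A))"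
    using constant_for_tautology by metis
  \<comment> \<open>Letters 0, 1, 2 become \<open>F\<close>, \<open>G\<close>, \<open>H\<close>; no
    other letter occurs, so the list need not be longer.\<close>
  have c': "derivable (Proof (PConst c) (JImp (JImp (JOr F G) H) (JImp F H)))" for F G H
    using c[of "\<lambda>n. [F, G, H] ! n"] by (simp add: JOr_def JNot_def)
  obtain d where "\<And>l k F. derivable (Proof (PConst d)
      (JImp (JOr (Proof l F) (Proof k F)) (Proof (PSum l k) F)))"
    by (rule constant_for_JPlus1) (rule that)
  then show thesis
    by (intro that[of "PApp (PConst c) (PConst d)"] derivable_PApp[OF c'])
qed

lemma term_for_PSum_right:
  obtains u where "\<And>l k F. derivable (Proof u (JImp (Proof k F) (Proof (PSum l k) F)))"
proof -
  let ?A = "Imp (Imp (Imp (Imp (Letter 0) Bot) (Letter 1)) (Letter 2)) (Imp (Letter 1) (Letter 2))"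
  have "tautology ?A"
    by (auto simp: tautology_def)
  then obtain c where c: "\<And>\<tau>. derivable (Proof (PConst c) (inst \<tau> ?A))"
    using constant_for_tautology by metis
  have c': "derivable (Proof (PConst c) (JImp (JImp (JOr F G) H) (JImp G H)))" for F G H
    using c[of "\<lambda>n. [F, G, H] ! n"] by (simp add: JOr_def JNot_def)
  obtain d where "\<And>l k F. derivable (Proof (PConst d)
      (JImp (JOr (Proof l F) (Proof k F)) (Proof (PSum l k) F)))"
    by (rule constant_for_JPlus1) (rule that)
  then show thesis
    by (intro that[of "PApp (PConst c) (PConst d)"] derivable_PApp[OF c'])
qed

lemma term_for_composition:
  obtains c where "\<And>F G H. derivable (Proof c (JImp (JImp F G) (JImp (JImp G H) (JImp F H))))"
proof -
  let ?A = "Imp (Imp (Letter 0) (Letter 1))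
    (Imp (Imp (Letter 1) (Letter 2)) (Imp (Letter 0) (Letter 2)))"
  have "tautology ?A"
    by (auto simp: tautology_def)
  then obtain c where c: "\<And>\<tau>. derivable (Proof (PConst c) (inst \<tau> ?A))"
    using constant_for_tautology by metis
  have "derivable (Proof (PConst c) (JImp (JImp F G) (JImp (JImp G H) (JImp F H))))" for F G H
    using c[of "\<lambda>n. [F, G, H] ! n"] by simp
  then show thesis
    using that by blast
qed

lemma term_for_summand:
  assumes "t \<in> set ts"
  shows "\<exists>u. \<forall>s F. derivable (Proof u (JImp (Proof t F) (Proof (foldr PSum ts s) F)))"
  using assms
proof (induction ts)
  case (Cons a ts)
  show ?case
  proof (cases "t = a")
    case True
    obtain u where "\<And>l k F. derivable (Proof u (JImp (Proof l F) (Proof (PSum l k) F)))"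
      by (rule term_for_PSum_left) (rule that)
    then show ?thesis
      using True by auto
  next
    case False
    then obtain u where u: "\<And>s F. derivable (Proof u (JImp (Proof t F) (Proof (foldr PSum ts s) F)))"
      using Cons by auto
    obtain d where d: "\<And>l k F. derivable (Proof d (JImp (Proof k F) (Proof (PSum l k) F)))"
      by (rule term_for_PSum_right) (rule that)
    obtain c where
      c: "\<And>F G H. derivable (Proof c (JImp (JImp F G) (JImp (JImp G H) (JImp F H))))"
      by (rule term_for_composition) (rule that)
    have "derivable (Proof (PApp (PApp c u) d)
        (JImp (Proof t F) (Proof (foldr PSum (a # ts) s) F)))" for s F
      using derivable_PApp[OF derivable_PApp[OF c u] d] by simp
    then show ?thesis
      by blast
  qed
qed simp

section \<open>Derivability uniform in the tail of the sum\<close>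

text \<open>The order of quantifiers is essential: one term works for all ways to extend the sum.\<close>

definition uniformly_derivable :: "pterm list \<Rightarrow> 'p mfm \<Rightarrow> bool" where
  "uniformly_derivable ts A \<longleftrightarrow>
     (\<exists>t. \<forall>s. derivable (Proof t (realize (foldr PSum ts s) A)))"

text \<open>The appended terms are absorbed into the arbitrary tail \<open>s\<close>.\<close>

lemma uniformly_derivable_append:
  "uniformly_derivable ts A \<Longrightarrow> uniformly_derivable (ts @ us) A"
  unfolding uniformly_derivable_def foldr_append by blast

lemma uniformly_derivable_mp:
  assumes "uniformly_derivable ts (MImp A B)" "uniformly_derivable ts A"
  shows "uniformly_derivable ts B"
  using assms derivable_PApp unfolding uniformly_derivable_def realize.simps by meson

lemma uniformly_derivable_tautology:
  assumes "\<And>v. mval v A"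
  shows "uniformly_derivable ts A"
proof -
  have "tautology (mskel A)"
    using assms by (simp add: tautology_def truth_mskel)
  then obtain c where "\<And>\<tau>. derivable (Proof (PConst c) (inst \<tau> (mskel A)))"
    using constant_for_tautology by metis
  then have "derivable (Proof (PConst c) (realize l A))" for l
    by (metis inst_mskel)
  then show ?thesis
    unfolding uniformly_derivable_def by blast
qed

text \<open>The assumptions become antecedents one by one until a tautology remains; each is then
  detached by application.\<close>

lemma uniformly_derivable_entailed:
  assumes "\<forall>G\<in>set Gs. uniformly_derivable ts G" "entails Gs {} {A}"
  shows "uniformly_derivable ts A"
  using assms
proof (induction Gs arbitrary: A)
  case Nil
  then show ?case
    by (auto simp: entails_def intro: uniformly_derivable_tautology)
next
  case (Cons G Gs)
  then have "entails Gs {} {MImp G A}"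
    by (auto simp: entails_def)
  then have "uniformly_derivable ts (MImp G A)"
    using Cons by simp
  then show ?case
    using Cons.prems(1) uniformly_derivable_mp by (metis list.set_intros(1))
qed

text \<open>Append the terms \<open>t1\<close>, \<open>t2\<close> of the two implications to the
  sum. Then \<open>PBang\<close> verifies these terms, \<open>u1\<close> and \<open>u2\<close> pass
  from them to the whole sum, and the constant \<open>d\<close> for \<open>JE\<close>
  applies.\<close>

lemma uniformly_derivable_RE:
  assumes "uniformly_derivable ts (MImp A B)" "uniformly_derivable ts (MImp B A)"
  shows "\<exists>us. uniformly_derivable (ts @ us) (MImp (Box A) (Box B))"
proof -
  obtain t1 where t1: "\<And>s. derivable (Proof t1 (realize (foldr PSum ts s) (MImp A B)))"
    using assms(1) unfolding uniformly_derivable_def by blast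
  obtain t2 where t2: "\<And>s. derivable (Proof t2 (realize (foldr PSum ts s) (MImp B A)))"
    using assms(2) unfolding uniformly_derivable_def by blast
  define ts' where "ts' = ts @ [t1, t2]"
  obtain u1 where u1: "\<And>s F. derivable (Proof u1 (JImp (Proof t1 F) (Proof (foldr PSum ts' s) F)))"
    using term_for_summand[of t1 ts'] unfolding ts'_def by auto
  obtain u2 where u2: "\<And>s F. derivable (Proof u2 (JImp (Proof t2 F) (Proof (foldr PSum ts' s) F)))"
    using term_for_summand[of t2 ts'] unfolding ts'_def by auto
  obtain d where d: "\<And>l F G. derivable (Proof (PConst d)
      (JImp (JAnd (Proof l (JImp F G)) (Proof l (JImp G F)))
        (JImp (Just (E l) F) (Just (E l) G))))"
    by (rule constant_for_JE) (rule that)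
  let ?X = "Imp (Imp (Imp (Imp (Letter 0) (Imp (Letter 1) Bot)) Bot) (Letter 2))
    (Imp (Letter 0) (Imp (Letter 1) (Letter 2)))"
  have "tautology ?X"
    by (auto simp: tautology_def)
  then obtain c where c: "\<And>\<tau>. derivable (Proof (PConst c) (inst \<tau> ?X))"
    using constant_for_tautology by metis
  have c': "derivable (Proof (PConst c) (JImp (JImp (JAnd F G) H) (JImp F (JImp G H))))" for F G H
    using c[of "\<lambda>n. [F, G, H] ! n"] by (simp add: JAnd_def JNot_def)
  let ?t = "PApp (PApp (PApp (PConst c) (PConst d)) (PApp u1 (PBang t1))) (PApp u2 (PBang t2))"
  have "derivable (Proof ?t (realize (foldr PSum ts' s) (MImp (Box A) (Box B))))" for s
  proof -
    let ?l = "foldr PSum ts' s"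
    let ?A = "realize ?l A" and ?B = "realize ?l B"
    \<comment> \<open>Uniformity is used here: the tail is chosen to contain \<open>t1\<close> and
      \<open>t2\<close> themselves, which makes the label equal to \<open>?l\<close>.\<close>
    have "derivable (Proof t1 (JImp ?A ?B))" "derivable (Proof t2 (JImp ?B ?A))"
      using t1[of "foldr PSum [t1, t2] s"] t2[of "foldr PSum [t1, t2] s"]
      by (simp_all add: ts'_def)
    then have "derivable (Proof (PApp u1 (PBang t1)) (Proof ?l (JImp ?A ?B)))"
      "derivable (Proof (PApp u2 (PBang t2)) (Proof ?l (JImp ?B ?A)))"
      using u1 u2 derivable_PApp derivable_PBang by blast+
    then show ?thesis
      using derivable_PApp[OF derivable_PApp[OF derivable_PApp[OF c' d]]] by simp
  qed
  then show ?thesis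
    unfolding uniformly_derivable_def ts'_def by blast
qed

text \<open>The initial list \<open>ts\<close> is arbitrary so that the second premise of a rule can
  extend the sum already built for the first. Only (RE) adds terms.\<close>

lemma GE_uniform:
  assumes "GE \<Gamma> \<Delta>"
  shows "\<exists>us Gs. (\<forall>G\<in>set Gs. uniformly_derivable (ts @ us) G) \<and>
    entails Gs (set_mset \<Gamma>) (set_mset \<Delta>)"
  using assms
proof (induction arbitrary: ts)
  case (AxP P)
  show ?case
    by (intro exI[of _ "[]"]) (auto simp: entails_def)
next
  case AxBot
  show ?case
    by (intro exI[of _ "[]"]) (auto simp: entails_def)
next
  case (ImpL \<Gamma> A \<Delta> B)
  obtain us Gs where 1: "\<forall>G\<in>set Gs. uniformly_derivable (ts @ us) G"
    "entails Gs (set_mset \<Gamma>) (set_mset (add_mset A \<Delta>))"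
    using ImpL.IH(1) by blast
  obtain us' Gs' where 2: "\<forall>G\<in>set Gs'. uniformly_derivable ((ts @ us) @ us') G"
    "entails Gs' (set_mset (add_mset B \<Gamma>)) (set_mset \<Delta>)"
    using ImpL.IH(2) by blast
  have "\<forall>G\<in>set (Gs @ Gs'). uniformly_derivable (ts @ (us @ us')) G"
    using 1(1) 2(1) uniformly_derivable_append[of "ts @ us" _ us'] by auto
  moreover have "entails (Gs @ Gs') (set_mset (add_mset (MImp A B) \<Gamma>)) (set_mset \<Delta>)"
    using 1(2) 2(2) unfolding entails_def by (simp add: ball_Un) blast
  ultimately show ?case
    by blast
next
  case (RE A B)
  obtain us Gs where 1: "\<forall>G\<in>set Gs. uniformly_derivable (ts @ us) G"
    "entails Gs {A} {B}"
    using RE.IH(1)[of ts] by auto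
  obtain us' Gs' where 2: "\<forall>G\<in>set Gs'. uniformly_derivable ((ts @ us) @ us') G"
    "entails Gs' {B} {A}"
    using RE.IH(2)[of "ts @ us"] by auto
  \<comment> \<open>The side assumptions of the premises are discharged here; only the implication
    between the boxes is passed on.\<close>
  have "uniformly_derivable (ts @ us) (MImp A B)"
    using 1 by (intro uniformly_derivable_entailed) (auto simp: entails_def)
  moreover have "uniformly_derivable ((ts @ us) @ us') (MImp B A)"
    using 2 by (intro uniformly_derivable_entailed) (auto simp: entails_def)
  ultimately obtain us'' where
    "uniformly_derivable (((ts @ us) @ us') @ us'') (MImp (Box A) (Box B))"
    using uniformly_derivable_RE uniformly_derivable_append by blast
  then have "\<forall>G\<in>set [MImp (Box A) (Box B)]. uniformly_derivable (ts @ (us @ us' @ us'')) G"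
    by simp
  moreover have "entails [MImp (Box A) (Box B)] (set_mset {#Box A#}) (set_mset {#Box B#})"
    by (auto simp: entails_def)
  ultimately show ?case
    by blast
next
  case (ImpR A \<Gamma> B \<Delta>)
  obtain us Gs where 1: "\<forall>G\<in>set Gs. uniformly_derivable (ts @ us) G"
    "entails Gs (set_mset (add_mset A \<Gamma>)) (set_mset (add_mset B \<Delta>))"
    using ImpR.IH by blast
  have "entails Gs (set_mset \<Gamma>) (set_mset (add_mset (MImp A B) \<Delta>))"
    using 1(2) unfolding entails_def by auto
  then show ?case
    using 1(1) by blast
next
  case (WeakL \<Gamma> \<Delta> A)
  obtain us Gs where 1: "\<forall>G\<in>set Gs. uniformly_derivable (ts @ us) G"
    "entails Gs (set_mset \<Gamma>) (set_mset \<Delta>)"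
    using WeakL.IH by blast
  have "entails Gs (set_mset (add_mset A \<Gamma>)) (set_mset \<Delta>)"
    using 1(2) unfolding entails_def by auto
  then show ?case
    using 1(1) by blast
next
  case (WeakR \<Gamma> \<Delta> A)
  obtain us Gs where 1: "\<forall>G\<in>set Gs. uniformly_derivable (ts @ us) G"
    "entails Gs (set_mset \<Gamma>) (set_mset \<Delta>)"
    using WeakR.IH by blast
  have "entails Gs (set_mset \<Gamma>) (set_mset (add_mset A \<Delta>))"
    using 1(2) unfolding entails_def by auto
  then show ?case
    using 1(1) by blast
qed simp_all

lemma GE_realizable:
  assumes "GE {#} {#A#}"
  shows "\<exists>l. derivable (realize l A)"
proof -
  obtain us Gs where "\<forall>G\<in>set Gs. uniformly_derivable us G" "entails Gs {} {A}"
    using GE_uniform[OF assms, of "[]"] by auto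
  then show ?thesis
    \<comment> \<open>Any tail completes the label, and reflection removes the outer proof
      term.\<close>
    using uniformly_derivable_entailed derivable_reflection
    unfolding uniformly_derivable_def by blast
qed

end

theorem mainTheorem7:
  fixes CS :: "(nat \<times> 'p::countable jfm) set"
  assumes "constant_specification CS"
    and "axiomatically_appropriate CS"
    and "schematic CS"
  shows "\<exists>r. realization r \<and>
    (\<forall>A. GE {#} {#A#} \<longrightarrow> JE_derivable CS (r A))"
proof -
  interpret schematic_appropriate CS
    using assms by unfold_locales
  \<comment> \<open>The label is chosen separately for each whole formula, so \<open>r\<close> need
    not commute with the connectives; if no label works, an arbitrary one is taken.\<close>
  define r where "r A = realize (SOME l. derivable (realize l A)) A" for A
  have "realization r"
    by (simp add: realization_def r_def forget_realize realize_in_FmJ)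
  moreover have "derivable (r A)" if "GE {#} {#A#}" for A
    unfolding r_def using GE_realizable[OF that] by (rule someI_ex)
  ultimately show ?thesis
    by blast
qed

end
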